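(* Let $\mathcal{S}$ be a countable set, let $p:\mathcal{S}^2\to[0,1]$ be transition probabilities on $\mathcal{S}$ (i.e. $\sum_{y} p(x,y)=1$ for all $x\in\mathcal{S}$), and let $q:\mathcal{S}\to[0,1)$ be a function. Assume there is a constant $K<\infty$ such that $g(x,x)\le K$ for all $x\in\mathcal{S}$, where $g$ is the Greens function of the chain. Then the annealed field is trapping if and only if the quenched field is trapping; that is, $\tilde{\pi}(x)=1$ for all $x\in\mathcal{S}$ if and only if $\pi(x)=1$ for all $x\in\mathcal{S}$.
   Context: For $x\in\mathcal{S}$, $\mathbf{P}_x$ denotes a probability measure under which $X_0,X_1,X_2,\ldots$ is a Markov chain with transition probabilities $p(\cdot,\cdot)$ started from $X_0=x$. The Greens function is $g(x,y)=\sum_{n=0}^\infty \mathbf{P}_x(X_n=y)$. Quenched problem: $T\subseteq\mathcal{S}$ is a random set of traps, independent of the chain $X_0,X_1,\ldots$, that contains each site $x$ independently with probability $q(x)$, i.e. $\mathbf{P}_x(\{x_1,\ldots,x_n\}\subset T)=\prod_{i=1}^n q(x_i)$ for every finite set $\{x_1,\ldots,x_n\}$ of distinct points of $\mathcal{S}$. Put $\pi(x)=\mathbf{P}_x(X_n\in T\text{ for some }n\ge 0)$. The quenched field is called trapping if $\pi(x)=1$ for all $x\in\mathcal{S}$, and non-trapping if $\pi(x)<1$ for some $x$. Annealed problem: $(T_n)_{n\ge 0}$ is an i.i.d. sequence of random subsets of $\mathcal{S}$, each distributed as $T$, independent of the chain. Put $\tilde{\pi}(x)=\mathbf{P}_x(X_n\in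 T_n\text{ for some }n\ge 0)$. The annealed field is called trapping if $\tilde{\pi}(x)=1$ for all $x\in\mathcal{S}$, and non-trapping if $\tilde{\pi}(x)<1$ for some $x$. *)

theory Defs
  imports "HOL-Probability.Probability"
begin

text \<open>The state space is a countable type \<open>'a\<close>, always equipped with its discrete
  sigma-algebra \<^term>\<open>count_space UNIV\<close>.\<close>

definition transition_probs :: "('a \<Rightarrow> 'a \<Rightarrow> real) \<Rightarrow> bool" where
  "transition_probs p \<longleftrightarrow>
     (\<forall>x y. 0 \<le> p x y \<and> p x y \<le> 1) \<and> (\<forall>x. (p x has_sum 1) UNIV)"

definition markov_chain_from ::
    "'w measure \<Rightarrow> (nat \<Rightarrow> 'w \<Rightarrow> 'a) \<Rightarrow> ('a \<Rightarrow> 'a \<Rightarrow> real) \<Rightarrow> 'a \<Rightarrow> bool" where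
  "markov_chain_from M X p x \<longleftrightarrow>
     prob_space M \<and>
     (\<forall>n. X n \<in> M \<rightarrow>\<^sub>M count_space UNIV) \<and>
     (AE \<omega> in M. X 0 \<omega> = x) \<and>
     (\<forall>n (s :: nat \<Rightarrow> 'a). \<P>(\<omega> in M. \<forall>i\<le>n. X i \<omega> = s i) > 0 \<longrightarrow>
        (\<forall>y. \<P>(\<omega> in M. X (Suc n) \<omega> = y \<bar> \<forall>i\<le>n. X i \<omega> = s i) = p (s n) y))"

text \<open>Here \<open>P x\<close> is the law under which the chain \<open>X\<close> is started from \<open>x\<close>.\<close>

definition greens_function ::
    "('a \<Rightarrow> 'w measure) \<Rightarrow> (nat \<Rightarrow> 'w \<Rightarrow> 'a) \<Rightarrow> 'a \<Rightarrow> 'a \<Rightarrow> ennreal" where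
  "greens_function P X x y = (\<Sum>n. emeasure (P x) {\<omega> \<in> space (P x). X n \<omega> = y})"

text \<open>The sigma-algebra on subsets of the state space generated by the events that a given site
  belongs to the subset, i.e. the product sigma-algebra under the identification of a subset
  with its indicator function. Random subsets are measurable maps into it.\<close>

definition subset_algebra :: "'a set measure" where
  "subset_algebra = sigma UNIV (range (\<lambda>x. {A. x \<in> A}))"

definition trap_set :: "'w measure \<Rightarrow> ('a \<Rightarrow> real) \<Rightarrow> ('w \<Rightarrow> 'a set) \<Rightarrow> bool" where
  "trap_set M q T \<longleftrightarrow>
     T \<in> M \<rightarrow>\<^sub>M subset_algebra \<and>
     (\<forall>A. finite A \<longrightarrow> \<P>(\<omega> in M. A \<subseteq> T \<omega>) = (\<Prod>x\<in>A. q x))"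

text \<open>Unlike \<^const>\<open>prob_space.indep_var\<close>, the two random variables may have different value types.\<close>

definition indep_rv ::
    "'w measure \<Rightarrow> 'b measure \<Rightarrow> ('w \<Rightarrow> 'b) \<Rightarrow> 'c measure \<Rightarrow> ('w \<Rightarrow> 'c) \<Rightarrow> bool" where
  "indep_rv M N Y L Z \<longleftrightarrow>
     Y \<in> M \<rightarrow>\<^sub>M N \<and> Z \<in> M \<rightarrow>\<^sub>M L \<and>
     prob_space.indep_set M
       {Y -` A \<inter> space M |A. A \<in> sets N} {Z -` B \<inter> space M |B. B \<in> sets L}"

definition quenched_traps ::
    "'w measure \<Rightarrow> (nat \<Rightarrow> 'w \<Rightarrow> 'a) \<Rightarrow> ('a \<Rightarrow> real) \<Rightarrow> ('w \<Rightarrow> 'a set) \<Rightarrow> bool" where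
  "quenched_traps M X q T \<longleftrightarrow>
     trap_set M q T \<and>
     indep_rv M
       (\<Pi>\<^sub>M n\<in>UNIV. count_space UNIV) (\<lambda>\<omega> n. X n \<omega>)
       subset_algebra T"

definition annealed_traps ::
    "'w measure \<Rightarrow> (nat \<Rightarrow> 'w \<Rightarrow> 'a) \<Rightarrow> ('w \<Rightarrow> 'a set) \<Rightarrow> (nat \<Rightarrow> 'w \<Rightarrow> 'a set) \<Rightarrow> bool" where
  "annealed_traps M X T Ts \<longleftrightarrow>
     prob_space.indep_vars M (\<lambda>n. subset_algebra) Ts UNIV \<and>
     (\<forall>n. distr M subset_algebra (Ts n) = distr M subset_algebra T) \<and>
     indep_rv M
       (\<Pi>\<^sub>M n\<in>UNIV. count_space UNIV) (\<lambda>\<omega> n. X n \<omega>)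
       (\<Pi>\<^sub>M n\<in>UNIV. subset_algebra) (\<lambda>\<omega> n. Ts n \<omega>)"

definition quenched_hit_prob ::
    "('a \<Rightarrow> 'w measure) \<Rightarrow> (nat \<Rightarrow> 'w \<Rightarrow> 'a) \<Rightarrow> ('w \<Rightarrow> 'a set) \<Rightarrow> 'a \<Rightarrow> real" where
  "quenched_hit_prob P X T x = \<P>(\<omega> in P x. \<exists>n. X n \<omega> \<in> T \<omega>)"

definition annealed_hit_prob ::
    "('a \<Rightarrow> 'w measure) \<Rightarrow> (nat \<Rightarrow> 'w \<Rightarrow> 'a) \<Rightarrow> (nat \<Rightarrow> 'w \<Rightarrow> 'a set) \<Rightarrow> 'a \<Rightarrow> real" where
  "annealed_hit_prob P X Ts x = \<P>(\<omega> in P x. \<exists>n. X n \<omega> \<in> Ts n \<omega>)"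

definition quenched_trapping ::
    "('a \<Rightarrow> 'w measure) \<Rightarrow> (nat \<Rightarrow> 'w \<Rightarrow> 'a) \<Rightarrow> ('w \<Rightarrow> 'a set) \<Rightarrow> bool" where
  "quenched_trapping P X T \<longleftrightarrow> (\<forall>x. quenched_hit_prob P X T x = 1)"

definition annealed_trapping ::
    "('a \<Rightarrow> 'w measure) \<Rightarrow> (nat \<Rightarrow> 'w \<Rightarrow> 'a) \<Rightarrow> (nat \<Rightarrow> 'w \<Rightarrow> 'a set) \<Rightarrow> bool" where
  "annealed_trapping P X Ts \<longleftrightarrow> (\<forall>x. annealed_hit_prob P X Ts x = 1)"

end

theory Submission
  imports Defs
begin

text \<open>
  Condition on the whole trajectory of the chain and integrate out the traps. A walker that knows
  its trajectory survives the quenched field with probability \<open>\<Prod>\<^sub>y (1 - q y)\<close>, the product running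
  over the \<^emph>\<open>distinct\<close> visited sites, and the annealed field with probability
  \<open>\<Prod>\<^sub>n (1 - q (X n))\<close>, where a site counts once per visit. A field is trapping from \<open>x\<close> exactly when
  the corresponding infinite product vanishes almost surely
  (\<open>quenched_hit_prob_eq_1_iff\<close>, \<open>annealed_hit_prob_eq_1_iff\<close>). The annealed product is the smaller
  one, so a quenched trapping field is annealed trapping.

  For the converse it is enough that, almost surely, the annealed product is positive wherever the
  quenched one is. As all \<open>q y\<close> are below 1, these products are positive if and only if the
  sums of \<open>q\<close> over distinct visited sites, respectively over all steps, are finite. The two sums
  differ by the number of visits per site, whose mean, counted from the first visit on, is at most
  \<open>K\<close>. This mean cannot be used under the event that the quenched product stays above a level \<open>c > 0\<close>, since
  that event depends on the future. Instead the walk is stopped: let \<open>G n\<close> be the event that the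
  product over the sites seen up to time \<open>n\<close> is at least \<open>c\<close>. Each \<open>G n\<close> is decided at time \<open>n\<close>, the
  events decrease in \<open>n\<close>, and a visit at a time \<open>n\<close> in \<open>G n\<close> belongs to a site first visited at a time
  \<open>k \<le> n\<close> in \<open>G k\<close>. The Markov property at time \<open>k\<close> bounds the expected number of such visits, hence

    \<open>E (\<Sum>n. q (X n) 1[G n]) \<le> K E (\<Sum>k. q (X k) 1[G k, X k is new]) \<le> K (- ln c)\<close>,

  because distinct sites with \<open>\<Prod> (1 - q y) \<ge> c\<close> have \<open>\<Sum> q y \<le> - ln c\<close>. So \<open>\<Sum>\<^sub>n q (X n)\<close> is almost
  surely finite on the event that all \<open>G n\<close> occur (\<open>AE_summable_if_site_survival_ge\<close>), and letting
  \<open>c\<close> run through a null sequence finishes the argument. The comparison holds for each starting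
  point separately.
\<close>

section \<open>Products of survival factors\<close>

text \<open>Quenched traps stay in place, so a site contributes one factor however often it is visited.\<close>

definition site_survival :: "('a \<Rightarrow> real) \<Rightarrow> 'a list \<Rightarrow> real" where
  "site_survival q l = (\<Prod>y\<in>set l. 1 - q y)"

text \<open>Annealed traps are drawn afresh at each time, so a site contributes one factor per visit.\<close>

definition step_survival :: "('a \<Rightarrow> real) \<Rightarrow> 'a list \<Rightarrow> real" where
  "step_survival q l = (\<Prod>i<length l. 1 - q (l ! i))"

lemma step_survival_Nil [simp]: "step_survival q [] = 1"
  by (simp add: step_survival_def)

lemma step_survival_snoc: "step_survival q (l @ [y]) = step_survival q l * (1 - q y)"
  by (simp add: step_survival_def nth_append)

lemma site_survival_Nil [simp]: "site_survival q [] = 1"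
  by (simp add: site_survival_def)

lemma site_survival_snoc:
  "site_survival q (l @ [y]) = site_survival q l * (if y \<in> set l then 1 else 1 - q y)"
  by (simp add: site_survival_def insert_absorb mult.commute)

lemma site_survival_antimono:
  assumes "\<And>x. 0 \<le> q x \<and> q x < 1" "set l \<subseteq> set l'"
  shows "site_survival q l' \<le> site_survival q l"
proof -
  have "site_survival q l' = site_survival q l * (\<Prod>y\<in>set l' - set l. 1 - q y)"
    unfolding site_survival_def using prod.subset_diff[OF assms(2)] by (simp add: mult.commute)
  also have "\<dots> \<le> site_survival q l * 1"
    using assms(1) by (intro mult_left_mono prod_le_1) (auto simp: site_survival_def less_imp_le intro!: prod_nonneg)
  finally show ?thesis by simp
qed

lemma site_survival_pos:
  assumes "\<And>x. 0 \<le> q x \<and> q x < 1"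
  shows "0 < site_survival q l"
  unfolding site_survival_def by (intro prod_pos) (simp add: assms)

lemma step_survival_le_site_survival:
  assumes "\<And>x. 0 \<le> q x \<and> q x < 1"
  shows "step_survival q l \<le> site_survival q l"
proof (induction l rule: rev_induct)
  case (snoc y l)
  have "step_survival q l * (1 - q y) \<le> site_survival q l * (if y \<in> set l then 1 else 1 - q y)"
    using snoc assms[of y] site_survival_pos[of q l, OF assms] by (intro mult_mono) auto
  then show ?case by (simp add: step_survival_snoc site_survival_snoc)
qed simp

text \<open>From \<open>1 - a \<le> exp (- a)\<close>: a lower bound on the product caps the sum of the trap
  probabilities of the distinct sites.\<close>

lemma sum_le_neg_ln_site_survival:
  assumes "\<And>x. 0 \<le> q x \<and> q x < 1"
  shows "(\<Sum>y\<in>set l. q y) \<le> - ln (site_survival q l)"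
proof -
  have "site_survival q l \<le> (\<Prod>y\<in>set l. exp (- q y))"
    unfolding site_survival_def
    using assms exp_ge_add_one_self[of "- q y" for y] by (intro prod_mono) (auto simp: less_imp_le)
  also have "\<dots> = exp (- (\<Sum>y\<in>set l. q y))"
    by (simp add: exp_sum sum_negf[symmetric])
  finally have "ln (site_survival q l) \<le> ln (exp (- (\<Sum>y\<in>set l. q y)))"
    by (rule ln_mono[OF _ site_survival_pos[of q l, OF assms]])
  then show ?thesis by simp
qed

text \<open>The infimum is the limit of the partial products, and an infinite product \<open>\<Prod> (1 - a i)\<close> of
  nonzero factors with summable \<open>a\<close> converges to a nonzero limit. The infimum is taken in
  \<^typ>\<open>ennreal\<close> because it will be integrated.\<close>

lemma INF_prod_pos_if_summable:
  fixes a :: "nat \<Rightarrow> real"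
  assumes a: "\<And>n. 0 \<le> a n \<and> a n < 1" and "summable a"
  shows "0 < (INF n. ennreal (\<Prod>i<n. 1 - a i))"
proof -
  define L where "L = (\<Prod>k. 1 + - a k)"
  have "1 + - a k \<noteq> 0" for k
    using a[of k] by auto
  moreover have conv: "convergent_prod (\<lambda>k. 1 + - a k)"
    using assms by (intro summable_imp_convergent_prod_real) (auto simp: less_le)
  ultimately have L0: "L \<noteq> 0"
    unfolding L_def by (intro prodinf_nonzero)
  have L: "(\<lambda>n. \<Prod>i\<le>n. 1 - a i) \<longlonglongrightarrow> L"
    using convergent_prod_LIMSEQ[OF conv] by (simp add: L_def)
  have dec: "decseq (\<lambda>n. \<Prod>i<n. 1 - a i)"
    using a by (intro decseq_SucI) (auto intro!: mult_left_le prod_nonneg simp: less_imp_le)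
  have L': "(\<lambda>n. \<Prod>i<n. 1 - a i) \<longlonglongrightarrow> L"
    using L by (subst filterlim_sequentially_Suc[symmetric]) (simp add: lessThan_Suc_atMost)
  have "L \<ge> 0"
    using a by (intro LIMSEQ_le_const[OF L'] exI[of _ 0]) (auto intro!: prod_nonneg simp: less_imp_le)
  have "ennreal L \<le> (INF n. ennreal (\<Prod>i<n. 1 - a i))"
    using decseq_ge[OF dec L'] by (intro INF_greatest ennreal_leI)
  then show ?thesis
    using \<open>L \<ge> 0\<close> L0 by (metis ennreal_eq_0_iff order_antisym zero_less_iff_neq_zero le_zero_eq)
qed

section \<open>Integrals over the fibres of a countably valued map\<close>

text \<open>This serves as conditioning on a countably valued variable \<open>f\<close>: on each fibre \<open>f \<omega>\<close> is a
  constant, so a randomised integrand \<open>g l\<close> may be replaced there by its conditional mean \<open>h l\<close>.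
  It is used with \<open>f\<close> the history of the process, both for the independence of the traps and for
  the Markov property.\<close>

lemma nn_integral_eq_if_eq_on_fibres:
  fixes f :: "'w \<Rightarrow> 'l::countable" and g h :: "'l \<Rightarrow> 'w \<Rightarrow> ennreal"
  assumes f [measurable]: "f \<in> M \<rightarrow>\<^sub>M count_space UNIV"
    and g [measurable]: "\<And>l. g l \<in> borel_measurable M"
    and h [measurable]: "\<And>l. h l \<in> borel_measurable M"
    and eq: "\<And>l. (\<integral>\<^sup>+\<omega>\<in>{\<omega>\<in>space M. f \<omega> = l}. g l \<omega> \<partial>M) = (\<integral>\<^sup>+\<omega>\<in>{\<omega>\<in>space M. f \<omega> = l}. h l \<omega> \<partial>M)"
  shows "(\<integral>\<^sup>+\<omega>. g (f \<omega>) \<omega> \<partial>M) = (\<integral>\<^sup>+\<omega>. h (f \<omega>) \<omega> \<partial>M)"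
proof -
  let ?F = "\<lambda>u j. \<integral>\<^sup>+\<omega>\<in>{\<omega>\<in>space M. to_nat (f \<omega>) = j}. u (f \<omega>) \<omega> \<partial>M"
  have split: "(\<integral>\<^sup>+\<omega>. u (f \<omega>) \<omega> \<partial>M) = (\<Sum>j. ?F u j)"
    if [measurable]: "\<And>l. u l \<in> borel_measurable M" for u :: "'l \<Rightarrow> 'w \<Rightarrow> ennreal"
  proof -
    have [measurable]: "(\<lambda>\<omega>. u (f \<omega>) \<omega>) \<in> borel_measurable M"
      by (rule measurable_compose_countable[OF _ f]) simp
    have "(\<integral>\<^sup>+\<omega>. u (f \<omega>) \<omega> \<partial>M)
        = (\<integral>\<^sup>+\<omega>. (\<Sum>j. u (f \<omega>) \<omega> * indicator {\<omega>\<in>space M. to_nat (f \<omega>) = j} \<omega>) \<partial>M)"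
    proof (rule nn_integral_cong)
      fix \<omega> assume "\<omega> \<in> space M"
      then have "(\<lambda>j. u (f \<omega>) \<omega> * indicator {\<omega>\<in>space M. to_nat (f \<omega>) = j} \<omega>)
          = (\<lambda>j. if j = to_nat (f \<omega>) then u (f \<omega>) \<omega> else 0)"
        by (auto simp: indicator_def)
      then show "u (f \<omega>) \<omega> = (\<Sum>j. u (f \<omega>) \<omega> * indicator {\<omega>\<in>space M. to_nat (f \<omega>) = j} \<omega>)"
        using sums_unique[OF sums_single[of "to_nat (f \<omega>)" "\<lambda>_. u (f \<omega>) \<omega>"]] by simp
    qed
    also have "\<dots> = (\<Sum>j. ?F u j)"
      by (rule nn_integral_suminf) simp
    finally show ?thesis .
  qed
  have "?F g j = ?F h j" for j
  proof (cases "\<exists>l::'l. j = to_nat l")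
    case True
    then obtain l :: 'l where j: "j = to_nat l" by auto
    have "?F u j = (\<integral>\<^sup>+\<omega>\<in>{\<omega>\<in>space M. f \<omega> = l}. u l \<omega> \<partial>M)" for u
      unfolding j by (intro nn_integral_cong) (auto simp: indicator_def)
    then show ?thesis using eq[of l] by simp
  next
    case False
    then have "{\<omega>\<in>space M. to_nat (f \<omega>) = j} = {}" by auto
    then show ?thesis by simp
  qed
  then show ?thesis using split[of g, OF g] split[of h, OF h] by simp
qed

section \<open>Histories of a process\<close>

text \<open>Histories are lists, rather than restricted functions, so that they form a countable type. The
  history of length \<open>n\<close> covers the times before \<open>n\<close>; it is empty for \<open>n = 0\<close>.\<close>

definition history :: "(nat \<Rightarrow> 'a) \<Rightarrow> nat \<Rightarrow> 'a list" where
  "history s n = map s [0..<n]"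

lemma history_0 [simp]: "history s 0 = []"
  and history_Suc: "history s (Suc n) = history s n @ [s n]"
  and length_history [simp]: "length (history s n) = n"
  and set_history: "set (history s n) = s ` {..<n}"
  and nth_history [simp]: "i < n \<Longrightarrow> history s n ! i = s i"
  by (auto simp: history_def)

lemma history_Suc_eq_iff:
  "length l = Suc n \<Longrightarrow> history s (Suc n) = l \<longleftrightarrow> (\<forall>i\<le>n. s i = l ! i)"
  by (auto simp: list_eq_iff_nth_eq less_Suc_eq_le history_def simp del: upt_Suc)

lemma measurable_history:
  fixes X :: "'w \<Rightarrow> nat \<Rightarrow> 'a::countable"
  assumes [measurable]: "\<And>i. (\<lambda>\<omega>. X \<omega> i) \<in> M \<rightarrow>\<^sub>M count_space UNIV"
  shows "(\<lambda>\<omega>. history (X \<omega>) n) \<in> M \<rightarrow>\<^sub>M count_space UNIV"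
proof (induction n)
  case (Suc n)
  note [measurable] = Suc
  have "(\<lambda>\<omega>. l @ [X \<omega> n]) \<in> M \<rightarrow>\<^sub>M count_space UNIV" for l
    by (rule measurable_compose[OF assms]) simp
  from measurable_compose_countable[where f = "\<lambda>l \<omega>. l @ [X \<omega> n]", OF this Suc]
  show ?case by (simp add: history_Suc)
qed simp

lemma sum_first_visits:
  fixes f :: "'a \<Rightarrow> 'b::comm_monoid_add"
  shows "(\<Sum>k<n. if s k \<in> set (history s k) then 0 else f (s k)) = (\<Sum>y\<in>set (history s n). f y)"
  by (induction n) (auto simp: history_Suc insert_absorb add.commute)

section \<open>Survival probability of a process independent of the traps\<close>

locale discrete_process = prob_space M
  for M :: "'w measure" +
  fixes X :: "nat \<Rightarrow> 'w \<Rightarrow> 'a::countable"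
  assumes measurable_X [measurable]: "\<And>n. X n \<in> M \<rightarrow>\<^sub>M count_space UNIV"
begin

abbreviation X_history :: "nat \<Rightarrow> 'w \<Rightarrow> 'a list" where
  "X_history n \<omega> \<equiv> history (\<lambda>i. X i \<omega>) n"

lemma measurable_X_history [measurable]: "X_history n \<in> M \<rightarrow>\<^sub>M count_space UNIV"
  by (rule measurable_history) simp

text \<open>\<open>Z\<close> is the source of randomness of the traps and \<open>B l\<close> the event that a walker with history \<open>l\<close>
  is still alive. By independence of \<open>Z\<close> and the process, \<open>w l\<close> is also the survival probability
  conditional on the history being \<open>l\<close>.\<close>

lemma emeasure_survival_upto:
  assumes indep: "indep_rv M (\<Pi>\<^sub>M n\<in>UNIV. count_space UNIV) (\<lambda>\<omega> n. X n \<omega>) L Z"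
    and B: "\<And>l. B l \<in> sets L"
    and w: "\<And>l. prob {\<omega>\<in>space M. Z \<omega> \<in> B l} = w l"
  shows "{\<omega>\<in>space M. Z \<omega> \<in> B (X_history n \<omega>)} \<in> sets M"
    and "emeasure M {\<omega>\<in>space M. Z \<omega> \<in> B (X_history n \<omega>)} = (\<integral>\<^sup>+\<omega>. ennreal (w (X_history n \<omega>)) \<partial>M)"
proof -
  have Z [measurable]: "Z \<in> M \<rightarrow>\<^sub>M L" using indep by (simp add: indep_rv_def)
  have [measurable]: "Measurable.pred M (\<lambda>\<omega>. Z \<omega> \<in> B l)" for l
    using measurable_sets[OF Z B[of l]] by (simp add: pred_def vimage_def Int_def conj_commute)
  have m: "Measurable.pred M (\<lambda>\<omega>. Z \<omega> \<in> B (X_history n \<omega>))"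
    by (rule measurable_compose_countable[OF _ measurable_X_history]) simp
  then show ev: "{\<omega>\<in>space M. Z \<omega> \<in> B (X_history n \<omega>)} \<in> sets M" by (simp add: pred_def)
  have prod: "prob {\<omega>\<in>space M. X_history n \<omega> = l \<and> Z \<omega> \<in> B l} = prob {\<omega>\<in>space M. X_history n \<omega> = l} * w l" for l
  proof -
    let ?A = "{s. history s n = l}"
    have "(\<lambda>s. history s n) \<in> (\<Pi>\<^sub>M n\<in>UNIV. count_space UNIV) \<rightarrow>\<^sub>M (count_space UNIV :: 'a list measure)"
      by (rule measurable_history) simp
    from measurable_sets[OF this, of "{l}"]
    have A: "?A \<in> sets (\<Pi>\<^sub>M n\<in>UNIV. count_space UNIV)"
      by (simp add: vimage_def space_PiM)
    have "prob (((\<lambda>\<omega> n. X n \<omega>) -` ?A \<inter> space M) \<inter> (Z -` B l \<inter> space M))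
        = prob ((\<lambda>\<omega> n. X n \<omega>) -` ?A \<inter> space M) * prob (Z -` B l \<inter> space M)"
      using indep A B unfolding indep_rv_def by (intro indep_setD) blast+
    moreover have "((\<lambda>\<omega> n. X n \<omega>) -` ?A \<inter> space M) \<inter> (Z -` B l \<inter> space M)
        = {\<omega>\<in>space M. X_history n \<omega> = l \<and> Z \<omega> \<in> B l}"
      "(\<lambda>\<omega> n. X n \<omega>) -` ?A \<inter> space M = {\<omega>\<in>space M. X_history n \<omega> = l}"
      "Z -` B l \<inter> space M = {\<omega>\<in>space M. Z \<omega> \<in> B l}" by auto
    ultimately show ?thesis using w[of l] by simp
  qed
  have w0: "0 \<le> w l" for l using w[of l] measure_nonneg by metis
  have "emeasure M {\<omega>\<in>space M. Z \<omega> \<in> B (X_history n \<omega>)}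
      = (\<integral>\<^sup>+\<omega>. (\<lambda>l \<omega>. indicator {\<omega>\<in>space M. Z \<omega> \<in> B l} \<omega>) (X_history n \<omega>) \<omega> \<partial>M)"
    by (subst nn_integral_indicator[OF ev, symmetric], intro nn_integral_cong) (auto simp: indicator_def)
  also have "\<dots> = (\<integral>\<^sup>+\<omega>. (\<lambda>l \<omega>. ennreal (w l)) (X_history n \<omega>) \<omega> \<partial>M)"
  proof (rule nn_integral_eq_if_eq_on_fibres)
    fix l
    have "(\<integral>\<^sup>+\<omega>\<in>{\<omega>\<in>space M. X_history n \<omega> = l}. indicator {\<omega>\<in>space M. Z \<omega> \<in> B l} \<omega> \<partial>M)
      = (\<integral>\<^sup>+\<omega>. indicator {\<omega>\<in>space M. X_history n \<omega> = l \<and> Z \<omega> \<in> B l} \<omega> \<partial>M)"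
      by (intro nn_integral_cong) (auto simp: indicator_def)
    also have "\<dots> = ennreal (w l) * emeasure M {\<omega>\<in>space M. X_history n \<omega> = l}"
      using prod[of l] w0[of l] by (simp add: emeasure_eq_measure ennreal_mult mult.commute)
    also have "\<dots> = (\<integral>\<^sup>+\<omega>\<in>{\<omega>\<in>space M. X_history n \<omega> = l}. ennreal (w l) \<partial>M)"
      by (subst nn_integral_cmult_indicator) auto
    finally show "(\<integral>\<^sup>+\<omega>\<in>{\<omega>\<in>space M. X_history n \<omega> = l}. indicator {\<omega>\<in>space M. Z \<omega> \<in> B l} \<omega> \<partial>M)
      = (\<integral>\<^sup>+\<omega>\<in>{\<omega>\<in>space M. X_history n \<omega> = l}. ennreal (w l) \<partial>M)" .
  qed auto
  finally show "emeasure M {\<omega>\<in>space M. Z \<omega> \<in> B (X_history n \<omega>)} = (\<integral>\<^sup>+\<omega>. ennreal (w (X_history n \<omega>)) \<partial>M)" .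
qed

text \<open>Survival forever is the decreasing limit of survival up to time \<open>n\<close>; monotone convergence moves
  the limit under the integral over histories, and a nonnegative integral vanishes only if its
  integrand does almost everywhere.\<close>

lemma hit_prob_eq_1_iff:
  assumes indep: "indep_rv M (\<Pi>\<^sub>M n\<in>UNIV. count_space UNIV) (\<lambda>\<omega> n. X n \<omega>) L Z"
    and B: "\<And>l. B l \<in> sets L"
    and w: "\<And>l. prob {\<omega>\<in>space M. Z \<omega> \<in> B l} = w l"
    and dec: "\<And>l y. B (l @ [y]) \<subseteq> B l"
    and hit: "\<And>\<omega>. H \<omega> \<longleftrightarrow> (\<exists>n. Z \<omega> \<notin> B (X_history n \<omega>))"
  shows "prob {\<omega>\<in>space M. H \<omega>} = 1 \<longleftrightarrow> (AE \<omega> in M. (INF n. ennreal (w (X_history n \<omega>))) = 0)"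
proof -
  define A where "A n = {\<omega>\<in>space M. Z \<omega> \<in> B (X_history n \<omega>)}" for n
  note up = emeasure_survival_upto[of L Z B w, OF indep B w, folded A_def]
  have decA: "decseq A"
    using dec by (intro decseq_SucI) (auto simp: A_def history_Suc)
  have Z [measurable]: "Z \<in> M \<rightarrow>\<^sub>M L" using indep by (simp add: indep_rv_def)
  have decw: "w (l @ [y]) \<le> w l" for l y
  proof -
    have "{\<omega>\<in>space M. Z \<omega> \<in> B l} \<in> events" for l
      using measurable_sets[OF Z B[of l]] by (simp add: vimage_def Int_def conj_commute)
    then show ?thesis
      unfolding w[symmetric] using dec by (intro finite_measure_mono) auto
  qed
  have "(\<integral>\<^sup>+\<omega>. ennreal (w (X_history i \<omega>)) \<partial>M) < \<infinity>" for i
    unfolding up(2)[symmetric] by (simp add: emeasure_eq_measure)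
  then have int: "(\<integral>\<^sup>+\<omega>. (INF n. ennreal (w (X_history n \<omega>))) \<partial>M) = (INF n. emeasure M (A n))"
    unfolding up(2)
    by (intro nn_integral_monotone_convergence_INF_decseq)
       (auto intro!: decseq_SucI le_funI ennreal_leI simp: history_Suc decw)
  have INT: "(\<Inter>n. A n) \<in> events" using up(1) by auto
  have "{\<omega>\<in>space M. H \<omega>} = space M - (\<Inter>n. A n)"
    using hit by (auto simp: A_def)
  then have "prob {\<omega>\<in>space M. H \<omega>} = 1 \<longleftrightarrow> prob (\<Inter>n. A n) = 0"
    using prob_compl[OF INT] by simp
  also have "\<dots> \<longleftrightarrow> emeasure M (\<Inter>n. A n) = 0"
    by (simp add: emeasure_eq_measure)
  also have "emeasure M (\<Inter>n. A n) = (INF n. emeasure M (A n))"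
    using up(1) decA by (intro INF_emeasure_decseq[symmetric]) auto
  also have "\<dots> = (\<integral>\<^sup>+\<omega>. (INF n. ennreal (w (X_history n \<omega>))) \<partial>M)" by (rule int[symmetric])
  also have "\<dots> = 0 \<longleftrightarrow> (AE \<omega> in M. (INF n. ennreal (w (X_history n \<omega>))) = 0)"
    by (rule nn_integral_0_iff_AE) simp
  finally show ?thesis .
qed

end

section \<open>Quenched and annealed hitting probabilities\<close>

lemma space_subset_algebra [simp]: "space subset_algebra = UNIV"
  by (simp add: subset_algebra_def)

lemma sets_subset_algebra_mem: "{A. x \<in> A} \<in> sets subset_algebra"
  unfolding subset_algebra_def by auto

lemma sets_subset_algebra_not_mem: "{A. x \<notin> A} \<in> sets subset_algebra"
proof -
  have "{A. x \<notin> A} = space subset_algebra - {A. x \<in> A}" by auto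
  then show ?thesis using sets_subset_algebra_mem by (metis sets.compl_sets)
qed

lemma sets_subset_algebra_avoid: "{A. set l \<inter> A = {}} \<in> sets subset_algebra"
proof -
  have "{A. set l \<inter> A = {}} = space subset_algebra \<inter> (\<Inter>x\<in>set l. {A. x \<notin> A})" by auto
  also have "\<dots> \<in> sets subset_algebra"
    using sets.top[of subset_algebra]
    by (cases "set l = {}") (auto intro!: sets.finite_INT sets_subset_algebra_not_mem)
  finally show ?thesis .
qed

text \<open>The hypothesis on a trap set only gives the probability that certain sites are all traps.
  Carrying along a second set of sites, required to be traps, makes the passage to avoidance an
  induction: an event about \<open>A\<close> splits according to whether one more site \<open>x\<close> is a trap.\<close>

lemma (in prob_space) trap_set_prob:
  assumes T: "trap_set M q T" and "finite A" "finite B" "A \<inter> B = {}"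
  shows "prob {\<omega>\<in>space M. B \<subseteq> T \<omega> \<and> A \<inter> T \<omega> = {}} = (\<Prod>y\<in>B. q y) * (\<Prod>y\<in>A. 1 - q y)"
  using assms(2-)
proof (induction A arbitrary: B rule: finite_induct)
  case empty
  then show ?case using T by (simp add: trap_set_def)
next
  case (insert x A)
  let ?E = "\<lambda>A B. {\<omega>\<in>space M. B \<subseteq> T \<omega> \<and> A \<inter> T \<omega> = {}}"
  have Tm: "T \<in> M \<rightarrow>\<^sub>M subset_algebra" using T by (simp add: trap_set_def)
  have [measurable]: "Measurable.pred M (\<lambda>\<omega>. y \<in> T \<omega>)" for y
    using measurable_sets[OF Tm sets_subset_algebra_mem[of y]]
    by (simp add: pred_def vimage_def Int_def conj_commute)
  have ev: "?E A B \<in> events" if "finite A" "finite B" for A B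
  proof -
    have "?E A B = {\<omega>\<in>space M. (\<forall>y\<in>B. y \<in> T \<omega>) \<and> (\<forall>y\<in>A. y \<notin> T \<omega>)}" by auto
    also have "\<dots> \<in> events" using that by measurable
    finally show ?thesis .
  qed
  have "?E A B = ?E (insert x A) B \<union> ?E A (insert x B)" by auto
  moreover have "prob (?E (insert x A) B \<union> ?E A (insert x B)) = prob (?E (insert x A) B) + prob (?E A (insert x B))"
    using insert.hyps insert.prems by (intro finite_measure_Union ev) auto
  ultimately have "prob (?E A B) = prob (?E (insert x A) B) + prob (?E A (insert x B))"
    by (rule trans[OF arg_cong])
  then show ?case
    using insert insert.IH[of B] insert.IH[of "insert x B"] by (simp add: algebra_simps)
qed

context discrete_process
begin

lemma quenched_hit_prob_eq_1_iff:
  assumes "quenched_traps M X q T"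
  shows "prob {\<omega>\<in>space M. \<exists>n. X n \<omega> \<in> T \<omega>} = 1
    \<longleftrightarrow> (AE \<omega> in M. (INF n. ennreal (site_survival q (X_history n \<omega>))) = 0)"
proof (rule hit_prob_eq_1_iff[of subset_algebra T "\<lambda>l. {A. set l \<inter> A = {}}"])
  show "prob {\<omega>\<in>space M. T \<omega> \<in> {A. set l \<inter> A = {}}} = site_survival q l" for l
    using trap_set_prob[of q T "set l" "{}"] assms
    by (simp add: quenched_traps_def site_survival_def)
  show "(\<exists>n. X n \<omega> \<in> T \<omega>) \<longleftrightarrow> (\<exists>n. T \<omega> \<notin> {A. set (X_history n \<omega>) \<inter> A = {}})" for \<omega>
    by (force simp: set_history)
qed (use assms in \<open>auto simp: quenched_traps_def sets_subset_algebra_avoid\<close>)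

lemma annealed_hit_prob_eq_1_iff:
  assumes q: "quenched_traps M X q T" and a: "annealed_traps M X T Ts"
  shows "prob {\<omega>\<in>space M. \<exists>n. X n \<omega> \<in> Ts n \<omega>} = 1
    \<longleftrightarrow> (AE \<omega> in M. (INF n. ennreal (step_survival q (X_history n \<omega>))) = 0)"
proof (rule hit_prob_eq_1_iff[of "\<Pi>\<^sub>M n\<in>UNIV. subset_algebra" "\<lambda>\<omega> n. Ts n \<omega>"
        "\<lambda>l. {t. \<forall>i<length l. l ! i \<notin> t i}"])
  have Ts: "Ts n \<in> M \<rightarrow>\<^sub>M subset_algebra" for n
    using a by (simp add: annealed_traps_def indep_vars_def)
  have T: "T \<in> M \<rightarrow>\<^sub>M subset_algebra" and trap: "trap_set M q T"
    using q by (auto simp: quenched_traps_def trap_set_def)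
  have one: "prob (Ts n -` {A. y \<notin> A} \<inter> space M) = 1 - q y" for n y
  proof -
    have "prob (Ts n -` {A. y \<notin> A} \<inter> space M) = measure (distr M subset_algebra (Ts n)) {A. y \<notin> A}"
      by (rule measure_distr[symmetric, OF Ts sets_subset_algebra_not_mem])
    also have "\<dots> = prob (T -` {A. y \<notin> A} \<inter> space M)"
      using a by (simp add: annealed_traps_def measure_distr[OF T sets_subset_algebra_not_mem])
    also have "\<dots> = prob {\<omega>\<in>space M. {} \<subseteq> T \<omega> \<and> {y} \<inter> T \<omega> = {}}"
      by (rule arg_cong[where f=prob]) auto
    also have "\<dots> = 1 - q y" using trap_set_prob[OF trap, of "{y}" "{}"] by simp
    finally show ?thesis .
  qed
  show "{t. \<forall>i<length l. l ! i \<notin> t i} \<in> sets (\<Pi>\<^sub>M n\<in>UNIV. subset_algebra)" for l :: "'a list"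
  proof -
    have [measurable]: "Measurable.pred (\<Pi>\<^sub>M n\<in>UNIV. subset_algebra) (\<lambda>t. y \<notin> t i)" for i :: nat and y :: 'a
      using measurable_sets[OF measurable_component_singleton[of i UNIV "\<lambda>_. subset_algebra"]
          sets_subset_algebra_not_mem[of y]]
      by (simp add: pred_def vimage_def Int_def conj_commute space_PiM)
    have "{t\<in>space (\<Pi>\<^sub>M n\<in>UNIV. subset_algebra). \<forall>i\<in>{..<length l}. l ! i \<notin> t i}
        \<in> sets (\<Pi>\<^sub>M n\<in>UNIV. subset_algebra)" by measurable
    then show ?thesis by (simp add: space_PiM Ball_def)
  qed
  show "prob {\<omega>\<in>space M. (\<lambda>n. Ts n \<omega>) \<in> {t. \<forall>i<length l. l ! i \<notin> t i}} = step_survival q l" for l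
  proof (cases "l = []")
    case False
    have "prob (\<Inter>i\<in>{..<length l}. Ts i -` {A. l ! i \<notin> A} \<inter> space M)
        = (\<Prod>i\<in>{..<length l}. prob (Ts i -` {A. l ! i \<notin> A} \<inter> space M))"
      using False a by (intro indep_varsD[of "\<lambda>n. subset_algebra" Ts UNIV])
        (auto simp: annealed_traps_def sets_subset_algebra_not_mem)
    moreover have "(\<Inter>i\<in>{..<length l}. Ts i -` {A. l ! i \<notin> A} \<inter> space M)
        = {\<omega>\<in>space M. (\<lambda>n. Ts n \<omega>) \<in> {t. \<forall>i<length l. l ! i \<notin> t i}}" using False by auto
    ultimately show ?thesis by (simp only: one step_survival_def)
  qed (simp add: prob_space)
  show "(\<exists>n. X n \<omega> \<in> Ts n \<omega>) \<longleftrightarrow>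
      (\<exists>n. (\<lambda>n. Ts n \<omega>) \<notin> {t. \<forall>i<length (X_history n \<omega>). X_history n \<omega> ! i \<notin> t i})" for \<omega>
    by auto
  show "{t. \<forall>i<length (l @ [y]). (l @ [y]) ! i \<notin> t i} \<subseteq> {t. \<forall>i<length l. l ! i \<notin> t i}" for l :: "'a list" and y
    by (force simp: nth_append less_Suc_eq)
qed (use a in \<open>simp add: annealed_traps_def\<close>)

end

section \<open>Revisits of a Markov chain\<close>

text \<open>The recursion splits off the first step, which matches an induction in which the Markov chain
  extends its known history by one site at a time.\<close>

fun n_step :: "('a \<Rightarrow> 'a \<Rightarrow> real) \<Rightarrow> nat \<Rightarrow> 'a \<Rightarrow> 'a \<Rightarrow> ennreal" where
  "n_step p 0 x y = (if x = y then 1 else 0)"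
| "n_step p (Suc m) x y = (\<integral>\<^sup>+z. ennreal (p x z) * n_step p m z y \<partial>count_space UNIV)"

locale discrete_markov_chain = discrete_process M X
  for M :: "'w measure" and X :: "nat \<Rightarrow> 'w \<Rightarrow> 'a::countable" +
  fixes p :: "'a \<Rightarrow> 'a \<Rightarrow> real" and x :: 'a
  assumes chain: "markov_chain_from M X p x"
    and p_nonneg: "\<And>x y. 0 \<le> p x y"
begin

lemma emeasure_history_step:
  assumes l: "length l = Suc n"
  shows "emeasure M {\<omega>\<in>space M. X_history (Suc n) \<omega> = l \<and> X (Suc n) \<omega> = z}
    = emeasure M {\<omega>\<in>space M. X_history (Suc n) \<omega> = l} * ennreal (p (last l) z)"
proof -
  have last: "l ! n = last l" using l by (cases l) (auto simp: last_conv_nth)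
  have eq: "X_history (Suc n) \<omega> = l \<longleftrightarrow> (\<forall>i\<le>n. X i \<omega> = l ! i)" for \<omega>
    by (rule history_Suc_eq_iff[OF l])
  show ?thesis
  (* The transition probabilities are prescribed only along histories of positive probability. *)
  proof (cases "\<P>(\<omega> in M. \<forall>i\<le>n. X i \<omega> = l ! i) > 0")
    case True
    then have "\<P>(\<omega> in M. X (Suc n) \<omega> = z \<bar> \<forall>i\<le>n. X i \<omega> = l ! i) = p (l ! n) z"
      using chain unfolding markov_chain_from_def by blast
    then have "prob {\<omega>\<in>space M. X_history (Suc n) \<omega> = l \<and> X (Suc n) \<omega> = z}
        = prob {\<omega>\<in>space M. X_history (Suc n) \<omega> = l} * p (last l) z"
      using True unfolding cond_prob_def eq last by (simp add: field_simps conj_commute)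
    then show ?thesis by (simp add: emeasure_eq_measure ennreal_mult p_nonneg)
  next
    case False
    then have z: "emeasure M {\<omega>\<in>space M. X_history (Suc n) \<omega> = l} = 0"
      unfolding eq by (simp add: emeasure_eq_measure zero_less_measure_iff measure_le_0_iff)
    have "emeasure M {\<omega>\<in>space M. X_history (Suc n) \<omega> = l \<and> X (Suc n) \<omega> = z}
      \<le> emeasure M {\<omega>\<in>space M. X_history (Suc n) \<omega> = l}"
      by (intro emeasure_mono) auto
    then show ?thesis using z by simp
  qed
qed

text \<open>The Markov property at a fixed time. The induction generalises over the history: one step of the
  chain appends the site \<open>z\<close> to \<open>l\<close> and leaves \<open>m\<close> further steps.\<close>

lemma emeasure_history_n_step:
  assumes "length l = Suc n"
  shows "emeasure M {\<omega>\<in>space M. X_history (Suc n) \<omega> = l \<and> X (n + m) \<omega> = y}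
    = emeasure M {\<omega>\<in>space M. X_history (Suc n) \<omega> = l} * n_step p m (last l) y"
  using assms
proof (induction m arbitrary: n l)
  case 0
  have "last l = X n \<omega>" if "X_history (Suc n) \<omega> = l" for \<omega>
    using that by (auto simp: history_Suc)
  then have "{\<omega>\<in>space M. X_history (Suc n) \<omega> = l \<and> X (n + 0) \<omega> = y}
      = (if last l = y then {\<omega>\<in>space M. X_history (Suc n) \<omega> = l} else {})" by auto
  then show ?case by simp
next
  case (Suc m)
  let ?E = "\<lambda>z. {\<omega>\<in>space M. X_history (Suc (Suc n)) \<omega> = l @ [z] \<and> X (Suc n + m) \<omega> = y}"
  have step: "emeasure M (?E z) = emeasure M {\<omega>\<in>space M. X_history (Suc n) \<omega> = l} *
      (ennreal (p (last l) z) * n_step p m z y)" for z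
  proof -
    have "{\<omega>\<in>space M. X_history (Suc (Suc n)) \<omega> = l @ [z]}
        = {\<omega>\<in>space M. X_history (Suc n) \<omega> = l \<and> X (Suc n) \<omega> = z}"
      by (auto simp: history_Suc[of _ "Suc n"])
    then show ?thesis
      using Suc.IH[of "l @ [z]" "Suc n"] Suc.prems emeasure_history_step[OF Suc.prems, of z]
      by (simp add: mult.assoc)
  qed
  have "{\<omega>\<in>space M. X_history (Suc n) \<omega> = l \<and> X (n + Suc m) \<omega> = y} = (\<Union>z. ?E z)"
    by (auto simp: history_Suc)
  then have "emeasure M {\<omega>\<in>space M. X_history (Suc n) \<omega> = l \<and> X (n + Suc m) \<omega> = y}
      = (\<integral>\<^sup>+z. emeasure M (?E z) \<partial>count_space UNIV)"
    by (simp, intro emeasure_UN_countable) (auto simp: disjoint_family_on_def)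
  also have "\<dots> = (\<integral>\<^sup>+z. emeasure M {\<omega>\<in>space M. X_history (Suc n) \<omega> = l} *
      (ennreal (p (last l) z) * n_step p m z y) \<partial>count_space UNIV)"
    by (simp only: step)
  finally show ?case by (simp add: nn_integral_cmult)
qed

lemma emeasure_X_eq_n_step: "emeasure M {\<omega>\<in>space M. X m \<omega> = y} = n_step p m x y"
proof -
  have start: "AE \<omega> in M. X_history (Suc 0) \<omega> = [x]"
    using chain by (simp add: markov_chain_from_def history_Suc)
  have "emeasure M {\<omega>\<in>space M. X m \<omega> = y}
      = emeasure M {\<omega>\<in>space M. X_history (Suc 0) \<omega> = [x] \<and> X (0 + m) \<omega> = y}"
    using start by (intro emeasure_eq_AE) auto
  also have "\<dots> = emeasure M {\<omega>\<in>space M. X_history (Suc 0) \<omega> = [x]} * n_step p m x y"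
    by (subst emeasure_history_n_step) auto
  also have "emeasure M {\<omega>\<in>space M. X_history (Suc 0) \<omega> = [x]} = 1"
    using start by (intro emeasure_eq_1_AE) auto
  finally show ?thesis by simp
qed

text \<open>A quantity \<open>r\<close> known at time \<open>k\<close>, counted again at every return to the site \<open>X k\<close>, has total
  expectation at most \<open>G\<close> times its own: given the history, the expected number of visits to \<open>X k\<close> from
  time \<open>k\<close> on is the Greens function at \<open>(X k, X k)\<close>.\<close>

lemma revisits_le:
  assumes green: "\<And>y. (\<Sum>m. n_step p m y y) \<le> G"
  shows "(\<Sum>m. \<integral>\<^sup>+\<omega>\<in>{\<omega>\<in>space M. X (k + m) \<omega> = X k \<omega>}. r (X_history (Suc k) \<omega>) \<partial>M)
    \<le> G * (\<integral>\<^sup>+\<omega>. r (X_history (Suc k) \<omega>) \<partial>M)"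
proof -
  have step: "(\<integral>\<^sup>+\<omega>\<in>{\<omega>\<in>space M. X (k + m) \<omega> = X k \<omega>}. r (X_history (Suc k) \<omega>) \<partial>M)
      = (\<integral>\<^sup>+\<omega>. r (X_history (Suc k) \<omega>) * n_step p m (X k \<omega>) (X k \<omega>) \<partial>M)" for m
  proof -
    have "(\<integral>\<^sup>+\<omega>\<in>{\<omega>\<in>space M. X (k + m) \<omega> = X k \<omega>}. r (X_history (Suc k) \<omega>) \<partial>M)
      = (\<integral>\<^sup>+\<omega>. (\<lambda>l \<omega>. r l * indicator {\<omega>\<in>space M. X (k + m) \<omega> = last l} \<omega>) (X_history (Suc k) \<omega>) \<omega> \<partial>M)"
      by (intro nn_integral_cong) (auto simp: history_Suc indicator_def)
    also have "\<dots> = (\<integral>\<^sup>+\<omega>. (\<lambda>l \<omega>. r l * n_step p m (last l) (last l)) (X_history (Suc k) \<omega>) \<omega> \<partial>M)"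
    proof (rule nn_integral_eq_if_eq_on_fibres[where f = "X_history (Suc k)"
          and g = "\<lambda>l \<omega>. r l * indicator {\<omega>\<in>space M. X (k + m) \<omega> = last l} \<omega>"
          and h = "\<lambda>l \<omega>. r l * n_step p m (last l) (last l)"])
      fix l
      let ?S = "{\<omega>\<in>space M. X_history (Suc k) \<omega> = l}"
      show "(\<integral>\<^sup>+\<omega>\<in>?S. (r l * indicator {\<omega>\<in>space M. X (k + m) \<omega> = last l} \<omega>) \<partial>M)
        = (\<integral>\<^sup>+\<omega>\<in>?S. (r l * n_step p m (last l) (last l)) \<partial>M)"
      proof (cases "length l = Suc k")
        case True
        have "(\<integral>\<^sup>+\<omega>\<in>?S. (r l * indicator {\<omega>\<in>space M. X (k + m) \<omega> = last l} \<omega>) \<partial>M)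
          = (\<integral>\<^sup>+\<omega>. r l * indicator {\<omega>\<in>space M. X_history (Suc k) \<omega> = l \<and> X (k + m) \<omega> = last l} \<omega> \<partial>M)"
          by (intro nn_integral_cong) (auto simp: indicator_def)
        also have "\<dots> = r l * (emeasure M ?S * n_step p m (last l) (last l))"
          unfolding emeasure_history_n_step[OF True, symmetric] by (rule nn_integral_cmult_indicator) simp
        also have "\<dots> = (\<integral>\<^sup>+\<omega>\<in>?S. (r l * n_step p m (last l) (last l)) \<partial>M)"
          by (subst nn_integral_cmult_indicator) (auto simp: ac_simps)
        finally show ?thesis .
      next
        case False
        then have "?S = {}" using length_history by blast
        then show ?thesis by simp
      qed
    qed auto
    also have "\<dots> = (\<integral>\<^sup>+\<omega>. r (X_history (Suc k) \<omega>) * n_step p m (X k \<omega>) (X k \<omega>) \<partial>M)"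
      by (simp add: history_Suc)
    finally show ?thesis .
  qed
  have "(\<Sum>m. \<integral>\<^sup>+\<omega>. r (X_history (Suc k) \<omega>) * n_step p m (X k \<omega>) (X k \<omega>) \<partial>M)
      = (\<integral>\<^sup>+\<omega>. (\<Sum>m. r (X_history (Suc k) \<omega>) * n_step p m (X k \<omega>) (X k \<omega>)) \<partial>M)"
    by (rule nn_integral_suminf[symmetric]) simp
  also have "\<dots> \<le> (\<integral>\<^sup>+\<omega>. G * r (X_history (Suc k) \<omega>) \<partial>M)"
    using green by (intro nn_integral_mono) (simp add: mult.commute[of G] mult_left_mono)
  also have "\<dots> = G * (\<integral>\<^sup>+\<omega>. r (X_history (Suc k) \<omega>) \<partial>M)"
    by (rule nn_integral_cmult) simp
  finally show ?thesis unfolding step .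
qed

text \<open>The stopping argument. In the proof, \<open>f\<close> is the trap probability of the current site, cut off once the
  product over distinct sites has dropped below \<open>c\<close>, and \<open>r\<close> keeps only the times at which the
  current site is new. Each value of \<open>f\<close> is charged to the first visit of the same site
  (\<open>first\<close>), the charges add up to at most \<open>- ln c\<close> along every trajectory (\<open>r_sum\<close>), and
  \<open>revisits_le\<close> bounds how often each charge is made.\<close>

lemma AE_summable_if_site_survival_ge:
  assumes q: "\<And>x. 0 \<le> q x \<and> q x < 1"
    and green: "\<And>y. (\<Sum>m. n_step p m y y) \<le> ennreal K"
    and c: "0 < c" "c \<le> 1"
  shows "AE \<omega> in M. (\<forall>n. c \<le> site_survival q (X_history n \<omega>)) \<longrightarrow> summable (\<lambda>n. q (X n \<omega>))"
proof -
  define f where "f l = (if c \<le> site_survival q l then ennreal (q (last l)) else 0)" for l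
  define r where "r l = (if last l \<in> set (butlast l) then 0 else f l)" for l
  define a where "a k m = (\<integral>\<^sup>+\<omega>\<in>{\<omega>\<in>space M. X (k + m) \<omega> = X k \<omega>}. r (X_history (Suc k) \<omega>) \<partial>M)" for k m
  have first: "f (X_history (Suc n) \<omega>)
      \<le> (\<Sum>k\<le>n. r (X_history (Suc k) \<omega>) * indicator {\<omega>\<in>space M. X n \<omega> = X k \<omega>} \<omega>)"
    if "\<omega> \<in> space M" for n \<omega>
  proof -
    (* The time of the first visit to the site occupied at time n. *)
    define k where "k = (LEAST k. X k \<omega> = X n \<omega>)"
    have k: "X k \<omega> = X n \<omega>" unfolding k_def by (rule LeastI) simp
    have kn: "k \<le> n" unfolding k_def by (rule Least_le) simp
    have new: "X k \<omega> \<notin> set (X_history k \<omega>)"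
    proof -
      have "X i \<omega> \<noteq> X k \<omega>" if "i < k" for i
        using that k not_less_Least[of i "\<lambda>k. X k \<omega> = X n \<omega>"] by (simp add: k_def)
      then show ?thesis by (force simp: set_history)
    qed
    have "site_survival q (X_history (Suc n) \<omega>) \<le> site_survival q (X_history (Suc k) \<omega>)"
      using kn by (intro site_survival_antimono q) (auto simp: set_history)
    then have "f (X_history (Suc n) \<omega>) \<le> r (X_history (Suc k) \<omega>) * indicator {\<omega>\<in>space M. X n \<omega> = X k \<omega>} \<omega>"
      using new k that by (auto simp: f_def r_def history_Suc)
    also have "\<dots> \<le> (\<Sum>k\<le>n. r (X_history (Suc k) \<omega>) * indicator {\<omega>\<in>space M. X n \<omega> = X k \<omega>} \<omega>)"
      using kn by (intro member_le_sum) auto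
    finally show ?thesis .
  qed
  have r_sum: "(\<Sum>k<N. r (X_history (Suc k) \<omega>)) \<le> ennreal (- ln c)" for N \<omega>
  proof (induction N)
    case (Suc N)
    show ?case
    (* If the product is still at least c, all charges so far come from distinct sites of a history
       whose trap probabilities have a small sum; otherwise the last charge is zero. *)
    proof (cases "c \<le> site_survival q (X_history (Suc N) \<omega>)")
      case True
      have "(\<Sum>k<Suc N. r (X_history (Suc k) \<omega>))
          \<le> (\<Sum>k<Suc N. if X k \<omega> \<in> set (X_history k \<omega>) then 0 else ennreal (q (X k \<omega>)))"
        by (intro sum_mono) (auto simp: r_def f_def history_Suc)
      also have "\<dots> = (\<Sum>y\<in>set (X_history (Suc N) \<omega>). ennreal (q y))"
        by (rule sum_first_visits)
      also have "\<dots> = ennreal (\<Sum>y\<in>set (X_history (Suc N) \<omega>). q y)"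
        using q by (intro sum_ennreal) auto
      also have "\<dots> \<le> ennreal (- ln c)"
      proof (rule ennreal_leI)
        have "ln c \<le> ln (site_survival q (X_history (Suc N) \<omega>))"
          using True c by (intro ln_mono) auto
        then show "(\<Sum>y\<in>set (X_history (Suc N) \<omega>). q y) \<le> - ln c"
          using sum_le_neg_ln_site_survival[of q "X_history (Suc N) \<omega>", OF q] by linarith
      qed
      finally show ?thesis .
    next
      case False
      then have "r (X_history (Suc N) \<omega>) = 0" by (simp add: r_def f_def)
      then show ?thesis using Suc by simp
    qed
  qed simp
  have partial: "(\<Sum>n<N. \<integral>\<^sup>+\<omega>. f (X_history (Suc n) \<omega>) \<partial>M) \<le> ennreal K * ennreal (- ln c)" for N
  proof -
    have "(\<integral>\<^sup>+\<omega>. f (X_history (Suc n) \<omega>) \<partial>M) \<le> (\<Sum>k\<le>n. a k (n - k))" for n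
    proof -
      have "(\<integral>\<^sup>+\<omega>. f (X_history (Suc n) \<omega>) \<partial>M)
          \<le> (\<integral>\<^sup>+\<omega>. (\<Sum>k\<le>n. r (X_history (Suc k) \<omega>) * indicator {\<omega>\<in>space M. X n \<omega> = X k \<omega>} \<omega>) \<partial>M)"
        by (intro nn_integral_mono first)
      also have "\<dots> = (\<Sum>k\<le>n. a k (n - k))"
        by (subst nn_integral_sum) (auto simp: a_def)
      finally show ?thesis .
    qed
    then have "(\<Sum>n<N. \<integral>\<^sup>+\<omega>. f (X_history (Suc n) \<omega>) \<partial>M) \<le> (\<Sum>n<N. \<Sum>k\<le>n. a k (n - k))"
      by (rule sum_mono)
    (* Sort by the time k of the first visit and the delay m until the current visit, then extend
       the triangle to a square to separate the two sums. *)
    also have "\<dots> = (\<Sum>(k, m)\<in>{(k, m). k + m < N}. a k m)"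
      by (rule sum.triangle_reindex[symmetric])
    also have "\<dots> \<le> (\<Sum>(k, m)\<in>{..<N} \<times> {..<N}. a k m)"
      by (rule sum_mono2) auto
    also have "\<dots> = (\<Sum>k<N. \<Sum>m<N. a k m)"
      by (rule sum.cartesian_product[symmetric])
    also have "\<dots> \<le> (\<Sum>k<N. \<Sum>m. a k m)"
      by (intro sum_mono sum_le_suminf) auto
    also have "\<dots> \<le> (\<Sum>k<N. ennreal K * (\<integral>\<^sup>+\<omega>. r (X_history (Suc k) \<omega>) \<partial>M))"
      unfolding a_def by (intro sum_mono revisits_le green)
    also have "\<dots> = ennreal K * (\<integral>\<^sup>+\<omega>. (\<Sum>k<N. r (X_history (Suc k) \<omega>)) \<partial>M)"
      by (simp add: sum_distrib_left nn_integral_sum)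
    also have "\<dots> \<le> ennreal K * (\<integral>\<^sup>+\<omega>. ennreal (- ln c) \<partial>M)"
      using r_sum by (intro mult_left_mono nn_integral_mono) auto
    finally show ?thesis by (simp add: emeasure_space_1)
  qed
  have "(\<integral>\<^sup>+\<omega>. (\<Sum>n. f (X_history (Suc n) \<omega>)) \<partial>M) = (\<Sum>n. \<integral>\<^sup>+\<omega>. f (X_history (Suc n) \<omega>) \<partial>M)"
    by (rule nn_integral_suminf) simp
  also have "\<dots> \<le> ennreal K * ennreal (- ln c)"
    using partial by (intro suminf_le_const) auto
  finally have "(\<integral>\<^sup>+\<omega>. (\<Sum>n. f (X_history (Suc n) \<omega>)) \<partial>M) \<noteq> \<infinity>"
    by (auto simp: top_unique ennreal_mult_eq_top_iff)
  then have "AE \<omega> in M. (\<Sum>n. f (X_history (Suc n) \<omega>)) \<noteq> \<infinity>"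
    by (intro nn_integral_PInf_AE) auto
  then show ?thesis
  proof eventually_elim
    case (elim \<omega>)
    show ?case
    proof
      assume good: "\<forall>n. c \<le> site_survival q (X_history n \<omega>)"
      have "f (X_history (Suc n) \<omega>) = ennreal (q (X n \<omega>))" for n
        using good[rule_format, of "Suc n"] by (simp add: f_def history_Suc)
      then have "(\<Sum>n. ennreal (q (X n \<omega>))) \<noteq> \<infinity>"
        using elim by simp
      then show "summable (\<lambda>n. q (X n \<omega>))"
        using q by (intro summable_suminf_not_top) auto
    qed
  qed
qed

text \<open>A positive infimum exceeds some level \<open>1 / Suc j\<close>, so countably many applications of the stopping
  argument cover the event that the product over distinct sites stays positive.\<close>

lemma AE_survival_zero_iff:
  assumes q: "\<And>x. 0 \<le> q x \<and> q x < 1"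
    and green: "\<And>y. (\<Sum>m. n_step p m y y) \<le> ennreal K"
  shows "(AE \<omega> in M. (INF n. ennreal (step_survival q (X_history n \<omega>))) = 0)
    \<longleftrightarrow> (AE \<omega> in M. (INF n. ennreal (site_survival q (X_history n \<omega>))) = 0)"
proof
  assume "AE \<omega> in M. (INF n. ennreal (site_survival q (X_history n \<omega>))) = 0"
  then show "AE \<omega> in M. (INF n. ennreal (step_survival q (X_history n \<omega>))) = 0"
  proof eventually_elim
    case (elim \<omega>)
    have "(INF n. ennreal (step_survival q (X_history n \<omega>))) \<le> (INF n. ennreal (site_survival q (X_history n \<omega>)))"
      by (intro INF_mono') (intro ennreal_leI step_survival_le_site_survival q)
    then show ?case using elim by simp
  qed
next
  assume step: "AE \<omega> in M. (INF n. ennreal (step_survival q (X_history n \<omega>))) = 0"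
  have "AE \<omega> in M. \<forall>j::nat. (\<forall>n. 1 / Suc j \<le> site_survival q (X_history n \<omega>)) \<longrightarrow> summable (\<lambda>n. q (X n \<omega>))"
    unfolding AE_all_countable
    by (intro allI AE_summable_if_site_survival_ge[of q K] q green) auto
  with step show "AE \<omega> in M. (INF n. ennreal (site_survival q (X_history n \<omega>))) = 0"
  proof eventually_elim
    case (elim \<omega>)
    show ?case
    proof (rule ccontr)
      assume "(INF n. ennreal (site_survival q (X_history n \<omega>))) \<noteq> 0"
      then obtain e where e: "0 < e" "e < (INF n. ennreal (site_survival q (X_history n \<omega>)))"
        by (metis dense zero_less_iff_neq_zero)
      then have "e < top" by (metis order_less_le_trans top_greatest)
      then have "0 < enn2real e" using e by (simp add: enn2real_positive_iff)
      then obtain j where j: "1 / Suc j < enn2real e"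
        using nat_approx_posE by blast
      have "1 / Suc j \<le> site_survival q (X_history n \<omega>)" for n
      proof -
        have "e \<le> ennreal (site_survival q (X_history n \<omega>))"
          using e(2) by (meson INF_lower UNIV_I less_imp_le order_trans)
        then have "enn2real e \<le> site_survival q (X_history n \<omega>)"
          using site_survival_pos[of q, OF q] by (intro enn2real_leI) (auto intro: less_imp_le)
        then show ?thesis using j by simp
      qed
      then have "summable (\<lambda>n. q (X n \<omega>))" using elim(2) by blast
      then have "0 < (INF n. ennreal (\<Prod>i<n. 1 - q (X i \<omega>)))"
        using q by (intro INF_prod_pos_if_summable) auto
      then show False using elim(1) by (simp add: step_survival_def)
    qed
  qed
qed

end

theorem theorem1p1:
  fixes p :: "'a::countable \<Rightarrow> 'a \<Rightarrow> real"
    and q :: "'a \<Rightarrow> real"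
    and P :: "'a \<Rightarrow> 'w measure"
    and X :: "nat \<Rightarrow> 'w \<Rightarrow> 'a"
    and T :: "'w \<Rightarrow> 'a set"
    and Ts :: "nat \<Rightarrow> 'w \<Rightarrow> 'a set"
    and K :: real
  assumes "transition_probs p"
    and "\<And>x. 0 \<le> q x \<and> q x < 1"
    and "\<And>x. markov_chain_from (P x) X p x"
    and "\<And>x. quenched_traps (P x) X q T"
    and "\<And>x. annealed_traps (P x) X T Ts"
    and "\<And>x. greens_function P X x x \<le> ennreal K"
  shows "annealed_trapping P X Ts \<longleftrightarrow> quenched_trapping P X T"
proof -
  have chain: "discrete_markov_chain (P x) X p x" for x
    using assms(1) assms(3)[of x]
    by (auto simp: discrete_markov_chain_def discrete_process_def discrete_process_axioms_def
        discrete_markov_chain_axioms_def markov_chain_from_def transition_probs_def)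
  have green: "(\<Sum>m. n_step p m y y) \<le> ennreal K" for y
    using assms(6)[of y] discrete_markov_chain.emeasure_X_eq_n_step[OF chain]
    by (simp add: greens_function_def)
  have "annealed_hit_prob P X Ts x = 1 \<longleftrightarrow> quenched_hit_prob P X T x = 1" for x
  proof -
    interpret discrete_markov_chain "P x" X p x by (rule chain)
    show ?thesis
      unfolding annealed_hit_prob_def quenched_hit_prob_def
        annealed_hit_prob_eq_1_iff[OF assms(4,5)] quenched_hit_prob_eq_1_iff[OF assms(4)]
      by (rule AE_survival_zero_iff[OF assms(2) green])
  qed
  then show ?thesis by (simp add: annealed_trapping_def quenched_trapping_def)
qed

end
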